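(* Let $G$ be a connected finite simple graph with no isolated vertex. The following conditions are equivalent: (1) $G$ is an edgewise strongly shellable (ESS) bipartite graph. (2) $G$ can be constructed from any vertex of $G$ by upward degree sequences (i.e. for every vertex $v$ of $G$, $G$ can be constructed from $v$ by upward degree sequences). (3) $G$ can be constructed from some vertex of $G$ by upward degree sequences.
   Context: A finite simple graph is ESS if its edges can be arranged in a linear order $E_1,\dots,E_t$ such that for each pair $i<j$ there exists $k<j$ with $|E_j\setminus E_k|=1$ and $E_i\cap E_j\subseteq E_k\subseteq E_i\cup E_j$. Construction by upward degree sequences. Let $t\ge1$ and let $d_1\ge\cdots\ge d_t\ge 0$ and $d_1'\ge\cdots\ge d_{d_t}'\ge d_{d_t+1}'=\cdots=d_{d_1}'=0$ be sequences of non-negative integers (the second has length $d_1$, and its entries with index greater than $d_t$ are $0$; if $d_1=0$ it is empty and $d_1'$ is read as $0$). Construct a graph as follows. Start with a vertex $w$. Take new vertices $V(w,1)=\{x_1,\dots,x_t\}$, all adjacent to $w$. Take new vertices $V(w,2)=\{y_1,\dots,y_{d_1}\}$; for each $i\in\{1,\dots,t\}$, $x_i$ is adjacent to the initial $d_i$ vertices $y_1,\dots,y_{d_i}$. Take new vertices $V(w,3)=\{z_1,\dots,z_{d_1'}\}$; for each $k\in\{1,\dots,d_t\}$, $y_k$ is adjacent to the initial $d_k'$ vertices $z_1,\dots,z_{d_k'}$. There are no other vertices or edges. $G$ can be constructed from the vertex $v$ by upward degree sequences if, for some such pair of sequences, $G$ is the resulting graph (up to relabelling vertices) with $v$ playing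 the role of $w$. *)

theory Defs
  imports Main
begin

text \<open>A graph is given by its vertex set \<open>V\<close> and its set \<open>E\<close> of edges, an edge being a two-element
  set of vertices.\<close>

definition finite_simple_graph :: "'a set \<Rightarrow> 'a set set \<Rightarrow> bool" where
  "finite_simple_graph V E \<longleftrightarrow> finite V \<and> (\<forall>e\<in>E. e \<subseteq> V \<and> card e = 2)"

text \<open>As usual, the graph without vertices does not count as connected.\<close>

definition connected_graph :: "'a set \<Rightarrow> 'a set set \<Rightarrow> bool" where
  "connected_graph V E \<longleftrightarrow> V \<noteq> {} \<and> (\<forall>u\<in>V. \<forall>v\<in>V. (u, v) \<in> {(x, y). {x, y} \<in> E}\<^sup>*)"

definition no_isolated_vertex :: "'a set \<Rightarrow> 'a set set \<Rightarrow> bool" where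
  "no_isolated_vertex V E \<longleftrightarrow> (\<forall>v\<in>V. \<exists>e\<in>E. v \<in> e)"

definition bipartite_graph :: "'a set \<Rightarrow> 'a set set \<Rightarrow> bool" where
  "bipartite_graph V E \<longleftrightarrow>
    (\<exists>A B. A \<union> B = V \<and> A \<inter> B = {} \<and> (\<forall>e\<in>E. \<exists>a\<in>A. \<exists>b\<in>B. e = {a, b}))"

text \<open>Edgewise strongly shellable; the linear order of the edges is a duplicate-free list
  (indexed from 0).\<close>

definition ESS :: "'a set set \<Rightarrow> bool" where
  "ESS E \<longleftrightarrow>
    (\<exists>es. distinct es \<and> set es = E \<and>
      (\<forall>i j. i < j \<and> j < length es \<longrightarrow>
        (\<exists>k<j. card (es ! j - es ! k) = 1 \<and>
          es ! i \<inter> es ! j \<subseteq> es ! k \<and> es ! k \<subseteq> es ! i \<union> es ! j)))"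

text \<open>The sequences are functions on \<open>nat\<close>, indexed from 1 as in the construction. Only the values
  \<open>d 1, \<dots>, d t\<close> and \<open>d' 1, \<dots>, d' (d 1)\<close> are relevant.\<close>

definition upward_degree_sequences :: "nat \<Rightarrow> (nat \<Rightarrow> nat) \<Rightarrow> (nat \<Rightarrow> nat) \<Rightarrow> bool" where
  "upward_degree_sequences t d d' \<longleftrightarrow>
    1 \<le> t \<and> antimono_on {1..t} d \<and>
    antimono_on {1..d t} d' \<and> (\<forall>k. d t < k \<and> k \<le> d 1 \<longrightarrow> d' k = 0)"

datatype uds_vertex = Wvert | Xvert nat | Yvert nat | Zvert nat

text \<open>If \<open>d 1 = 0\<close>, the second sequence is empty and its first entry is read as 0.\<close>

definition uds_vertices :: "nat \<Rightarrow> (nat \<Rightarrow> nat) \<Rightarrow> (nat \<Rightarrow> nat) \<Rightarrow> uds_vertex set" where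
  "uds_vertices t d d' =
    {Wvert} \<union> Xvert ` {1..t} \<union> Yvert ` {1..d 1} \<union> Zvert ` {1..(if d 1 = 0 then 0 else d' 1)}"

definition uds_edges :: "nat \<Rightarrow> (nat \<Rightarrow> nat) \<Rightarrow> (nat \<Rightarrow> nat) \<Rightarrow> uds_vertex set set" where
  "uds_edges t d d' =
    {{Wvert, Xvert i} | i. i \<in> {1..t}} \<union>
    {{Xvert i, Yvert j} | i j. i \<in> {1..t} \<and> j \<in> {1..d i}} \<union>
    {{Yvert k, Zvert l} | k l. k \<in> {1..d t} \<and> l \<in> {1..d' k}}"

definition constructible_from :: "'a set \<Rightarrow> 'a set set \<Rightarrow> 'a \<Rightarrow> bool" where
  "constructible_from V E v \<longleftrightarrow>
    (\<exists>t d d' f. upward_degree_sequences t d d' \<and>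
      bij_betw f (uds_vertices t d d') V \<and> (\<lambda>e. f ` e) ` uds_edges t d d' = E \<and> f Wvert = v)"

end

theory Submission
  imports Defs
begin

text \<open>In an ESS ordering the condition is only restrictive for disjoint edges, where it asks for an
  earlier edge joining them. Hence a bipartite graph is ESS iff it contains no two disjoint edges
  without a joining edge, i.e. iff it is a chain graph: on each side, the neighbourhoods are
  linearly ordered by inclusion. Conversely, the edges of a chain graph are ordered by adding the
  vertices of one side in order of decreasing neighbourhoods. Graphs constructed by upward degree
  sequences are chain graphs by inspection. In a chain graph, given \<open>v\<close>, one enumerates the
  neighbours of \<open>v\<close>, the other vertices on the side of \<open>v\<close>, and the remaining vertices, each by
  decreasing degree; all neighbourhoods then become initial segments.\<close>

section \<open>Chain graphs and their nested neighbourhoods\<close>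

definition nbhd :: "'a set set \<Rightarrow> 'a \<Rightarrow> 'a set" where
  "nbhd E u = {w. {u, w} \<in> E}"

lemma nbhd_sym: "w \<in> nbhd E u \<longleftrightarrow> u \<in> nbhd E w"
  by (simp add: nbhd_def insert_commute)

text \<open>The assumption \<open>cross\<close> is trivial when the two edges share an end, so it
  speaks about disjoint edges: some edge must join them. Stating it with labelled ends avoids any
  mention of disjointness and makes it symmetric in the two sides.\<close>

locale chain_bipartition =
  fixes E :: "'a set set" and A B :: "'a set"
  assumes finA: "finite A" and finB: "finite B"
    and disj: "A \<inter> B = {}"
    and edgeE: "e \<in> E \<Longrightarrow> \<exists>a\<in>A. \<exists>b\<in>B. e = {a, b}"
    and cross: "\<lbrakk>a \<in> A; a' \<in> A; b \<in> B; b' \<in> B; {a, b} \<in> E; {a', b'} \<in> E\<rbrakk>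
      \<Longrightarrow> {a, b'} \<in> E \<or> {a', b} \<in> E"
begin

text \<open>Facts about neighbourhoods are proved for vertices of \<open>A\<close> only; this
  transfers them to \<open>B\<close>.\<close>

lemma swap: "chain_bipartition E B A"
proof
  show "finite B" "finite A" "B \<inter> A = {}" using finA finB disj by auto
next
  fix e assume "e \<in> E"
  then show "\<exists>a\<in>B. \<exists>b\<in>A. e = {a, b}" using edgeE[of e] by (blast intro: insert_commute)
next
  fix a a' b b' assume "a \<in> B" "a' \<in> B" "b \<in> A" "b' \<in> A" "{a, b} \<in> E" "{a', b'} \<in> E"
  then show "{a, b'} \<in> E \<or> {a', b} \<in> E"
    using cross[of b b' a a'] by (auto simp: insert_commute)
qed

lemma nbhd_subset: "a \<in> A \<Longrightarrow> nbhd E a \<subseteq> B"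
  using edgeE disj by (fastforce simp: nbhd_def doubleton_eq_iff)

lemma finite_nbhd: "a \<in> A \<Longrightarrow> finite (nbhd E a)"
  using nbhd_subset finB finite_subset by metis

text \<open>Witnesses against both inclusions would be the far ends of two edges that
  \<open>cross\<close> forbids.\<close>

lemma nbhd_linear:
  assumes "a \<in> A" "a' \<in> A"
  shows "nbhd E a \<subseteq> nbhd E a' \<or> nbhd E a' \<subseteq> nbhd E a"
proof (rule ccontr)
  assume "\<not> ?thesis"
  then obtain b b' where "b \<in> nbhd E a" "b \<notin> nbhd E a'" "b' \<in> nbhd E a'" "b' \<notin> nbhd E a"
    by blast
  moreover then have "b \<in> B" "b' \<in> B" using nbhd_subset assms by blast+
  ultimately show False using cross[of a a' b b'] assms by (simp add: nbhd_def)
qed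

text \<open>Nested finite sets are compared by their cardinalities, so sorting by degree is sorting
  by inclusion of neighbourhoods.\<close>

lemma nbhd_mono:
  assumes "a \<in> A" "a' \<in> A" "card (nbhd E a) \<le> card (nbhd E a')"
  shows "nbhd E a \<subseteq> nbhd E a'"
  using nbhd_linear[OF assms(1,2)] card_seteq[OF finite_nbhd[OF assms(1)] _ assms(3)] by blast

end

section \<open>Strong shellability and the chain condition\<close>

text \<open>The edges of \<open>F\<close> may follow those of \<open>E\<close> in any order: two old
  edges are handled by the old ordering, an old and a new one by \<open>join\<close>, and for two
  new edges the earlier one serves itself, since both contain \<open>a\<close>.\<close>

lemma ESS_append_star:
  assumes "ESS E" and "finite F" and "E \<inter> F = {}"
    and card2: "\<And>e. e \<in> F \<Longrightarrow> card e = 2"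
    and centre: "\<And>e. e \<in> F \<Longrightarrow> a \<in> e"
    and join: "\<And>e f. e \<in> E \<Longrightarrow> f \<in> F \<Longrightarrow>
      \<exists>g\<in>E. card (f - g) = 1 \<and> e \<inter> f \<subseteq> g \<and> g \<subseteq> e \<union> f"
  shows "ESS (E \<union> F)"
proof -
  obtain es where es: "distinct es" "set es = E"
    and shell: "\<And>i j. i < j \<Longrightarrow> j < length es \<Longrightarrow>
        \<exists>k<j. card (es ! j - es ! k) = 1 \<and> es ! i \<inter> es ! j \<subseteq> es ! k \<and> es ! k \<subseteq> es ! i \<union> es ! j"
    using \<open>ESS E\<close> unfolding ESS_def by blast
  obtain fs where fs: "set fs = F" "distinct fs"
    using finite_distinct_list[OF \<open>finite F\<close>] by blast
  define gs where "gs = es @ fs"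
  have old: "gs ! k = es ! k" if "k < length es" for k
    using that by (simp add: gs_def nth_append)
  have new: "gs ! k \<in> F" if "length es \<le> k" "k < length gs" for k
    using that fs(1) by (auto simp: gs_def nth_append)
  have dist: "distinct gs" "set gs = E \<union> F"
    using es fs \<open>E \<inter> F = {}\<close> by (auto simp: gs_def)
  have "\<exists>k<j. card (gs ! j - gs ! k) = 1 \<and> gs ! i \<inter> gs ! j \<subseteq> gs ! k \<and> gs ! k \<subseteq> gs ! i \<union> gs ! j"
    if ij: "i < j" "j < length gs" for i j
  proof (cases "j < length es")
    case True
    then obtain k where "k < j" "card (es ! j - es ! k) = 1 \<and> es ! i \<inter> es ! j \<subseteq> es ! k \<and> es ! k \<subseteq> es ! i \<union> es ! j"
      using shell ij(1) by meson
    moreover have "gs ! i = es ! i" "gs ! j = es ! j" "gs ! k = es ! k"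
      using old True ij(1) \<open>k < j\<close> by simp_all
    ultimately show ?thesis by (intro exI[of _ k]) simp
  next
    case False
    then have jF: "gs ! j \<in> F" using new ij by simp
    show ?thesis
    proof (cases "i < length es")
      case True
      then have "gs ! i \<in> E" using old es(2) by auto
      then obtain g where "g \<in> E" "card (gs ! j - g) = 1 \<and> gs ! i \<inter> gs ! j \<subseteq> g \<and> g \<subseteq> gs ! i \<union> gs ! j"
        using join jF by blast
      moreover then obtain k where "k < length es" "es ! k = g"
        using es(2) by (metis in_set_conv_nth)
      ultimately show ?thesis using False old[of k] by (intro exI[of _ k]) simp
    next
      case False
      then have iF: "gs ! i \<in> F" using new ij by simp
      \<comment> \<open>Two distinct edges of the star differ only in the end other than
        \<open>a\<close>, so the choice \<open>k = i\<close> works.\<close>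
      have "gs ! i \<noteq> gs ! j" using dist(1) ij by (simp add: nth_eq_iff_index_eq)
      have star: "\<exists>p. e = {a, p}" if "e \<in> F" for e
        using card2[OF that] centre[OF that] by (auto simp: card_2_iff)
      obtain p q where "gs ! i = {a, p}" "gs ! j = {a, q}" using star[OF iF] star[OF jF] by metis
      moreover have "card (gs ! j) = 2" using card2[OF jF] .
      ultimately have "gs ! j - gs ! i = {q}" using \<open>gs ! i \<noteq> gs ! j\<close> by (cases "a = q") auto
      then have "card (gs ! j - gs ! i) = 1" by simp
      then show ?thesis using ij by blast
    qed
  qed
  then show ?thesis unfolding ESS_def using dist by blast
qed

text \<open>The edge that the ordering supplies for the later of the two misses exactly one of its
  two ends. It is therefore not that edge, and it cannot be the earlier one, which misses both
  ends.\<close>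

lemma ESS_joining_edge:
  assumes "ESS E" and card2: "\<And>e. e \<in> E \<Longrightarrow> card e = 2"
    and "e \<in> E" "f \<in> E" "e \<inter> f = {}"
  shows "\<exists>g\<in>E. g \<subseteq> e \<union> f \<and> g \<noteq> e \<and> g \<noteq> f"
proof -
  obtain es where es: "distinct es" "set es = E"
    and shell: "\<And>i j. i < j \<Longrightarrow> j < length es \<Longrightarrow>
        \<exists>k<j. card (es ! j - es ! k) = 1 \<and> es ! i \<inter> es ! j \<subseteq> es ! k \<and> es ! k \<subseteq> es ! i \<union> es ! j"
    using \<open>ESS E\<close> unfolding ESS_def by blast
  have main: "\<exists>g\<in>E. g \<subseteq> es ! i \<union> es ! j \<and> g \<noteq> es ! i \<and> g \<noteq> es ! j"
    if ij: "i < j" "j < length es" "es ! i \<inter> es ! j = {}" for i j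
  proof -
    obtain k where k: "k < j" "card (es ! j - es ! k) = 1" "es ! k \<subseteq> es ! i \<union> es ! j"
      using shell[OF ij(1,2)] by blast
    have "card (es ! j) = 2" using card2 es(2) ij by auto
    then have "es ! k \<noteq> es ! i" using k(2) ij(3) by (auto simp: Diff_triv Int_commute)
    moreover have "es ! k \<noteq> es ! j" using k(2) by auto
    moreover have "es ! k \<in> E" using es(2) k(1) ij by auto
    ultimately show ?thesis using k(3) by blast
  qed
  obtain i j where ij: "i < length es" "j < length es" "es ! i = e" "es ! j = f"
    using es(2) assms(3,4) by (metis in_set_conv_nth)
  \<comment> \<open>The claim is symmetric in \<open>e\<close> and \<open>f\<close>, so it does not
    matter which of them comes first.\<close>
  have "e \<noteq> f" using assms(5) card2[OF assms(3)] by auto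
  then have "i < j \<or> j < i" using ij by auto
  then show ?thesis
    using main[of i j] main[of j i] ij assms(5) by (metis Int_commute Un_commute)
qed

text \<open>Each vertex of \<open>A\<close> contributes the star of its edges, and the stars are
  appended one after another by decreasing degree of their centres.\<close>

lemma (in chain_bipartition) ESS_edges: "ESS E"
proof -
  have "S \<subseteq> A \<longrightarrow> ESS {e \<in> E. e \<inter> S \<noteq> {}}" if "finite S" for S
    using that
  \<comment> \<open>The rule inserts an element of maximal rank; the sign turns this into minimal
    degree. It does not guarantee that the inserted element is new, whence the case distinction
    below.\<close>
  proof (induction S rule: finite_ranking_induct[where f = "\<lambda>a. - int (card (nbhd E a))"])
    case empty
    show ?case by (auto simp: ESS_def)
  next
    case (insert a S)
    show ?case
    proof (cases "a \<in> S")
      case True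
      then show ?thesis using insert.IH by (simp add: insert_absorb)
    next
      case False
      show ?thesis
      proof
        assume sub: "insert a S \<subseteq> A"
        define F where "F = {e \<in> E. a \<in> e}"
        have Fform: "\<exists>b\<in>B. e = {a, b} \<and> a \<noteq> b" if "e \<in> F" for e
          using that sub edgeE disj unfolding F_def by fastforce
        have Aform: "\<exists>b\<in>B. e = {c, b} \<and> c \<noteq> b" if "e \<in> E" "c \<in> e" "c \<in> A" for e c
          using that edgeE disj by fastforce
        have "ESS ({e \<in> E. e \<inter> S \<noteq> {}} \<union> F)"
        proof (rule ESS_append_star[where a = a])
          show "ESS {e \<in> E. e \<inter> S \<noteq> {}}" using insert.IH sub by blast
          have "F \<subseteq> (\<lambda>b. {a, b}) ` B" using Fform by blast
          then show "finite F" using finB finite_surj by blast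
          show "{e \<in> E. e \<inter> S \<noteq> {}} \<inter> F = {}"
            using Fform False sub disj by fastforce
          show "card e = 2" if "e \<in> F" for e using Fform[OF that] by auto
          show "a \<in> e" if "e \<in> F" for e using that by (simp add: F_def)
          show "\<exists>g\<in>{e \<in> E. e \<inter> S \<noteq> {}}. card (f - g) = 1 \<and> e \<inter> f \<subseteq> g \<and> g \<subseteq> e \<union> f"
            if e: "e \<in> {e \<in> E. e \<inter> S \<noteq> {}}" and f: "f \<in> F" for e f
          proof -
            obtain c where c: "c \<in> S" "c \<in> e" using e by blast
            have cA: "c \<in> A" "a \<in> A" "c \<noteq> a" using c sub False by auto
            obtain b where b: "b \<in> B" "e = {c, b}" using Aform[of e c] e c cA by blast
            obtain b' where b': "b' \<in> B" "f = {a, b'}" "a \<noteq> b'" using Fform f by blast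
            \<comment> \<open>The centre \<open>c\<close> came before \<open>a\<close>, so the end
              \<open>b'\<close> of the new edge is also a neighbour of \<open>c\<close>. The edge
              \<open>{c, b'}\<close> then links \<open>e\<close> and \<open>f\<close>, and it is
              \<open>e\<close> itself if \<open>b = b'\<close>.\<close>
            have "card (nbhd E a) \<le> card (nbhd E c)" using insert.hyps c by force
            then have "nbhd E a \<subseteq> nbhd E c" using nbhd_mono cA by blast
            moreover have "b' \<in> nbhd E a" using f b' by (simp add: F_def nbhd_def)
            ultimately have "{c, b'} \<in> E" by (auto simp: nbhd_def)
            moreover have "f - {c, b'} = {a}" using b' cA by auto
            moreover have "e \<inter> f \<subseteq> {c, b'}" using b b' cA disj by auto
            moreover have "{c, b'} \<subseteq> e \<union> f" using b b' by auto
            ultimately show ?thesis using c by (intro bexI[of _ "{c, b'}"]) auto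
          qed
        qed
        moreover have "{e \<in> E. e \<inter> S \<noteq> {}} \<union> F = {e \<in> E. e \<inter> insert a S \<noteq> {}}"
          by (auto simp: F_def)
        ultimately show "ESS {e \<in> E. e \<inter> insert a S \<noteq> {}}" by simp
      qed
    qed
  qed
  moreover have "{e \<in> E. e \<inter> A \<noteq> {}} = E" using edgeE by fastforce
  ultimately show ?thesis using finA by (metis order_refl)
qed

text \<open>Forwards, the joining edge of two disjoint edges is one of the two that
  \<open>cross\<close> asks for; backwards, the ordering by stars applies.\<close>

lemma ESS_bipartite_iff_chain:
  assumes "finite_simple_graph V E"
  shows "ESS E \<and> bipartite_graph V E \<longleftrightarrow> (\<exists>A B. A \<union> B = V \<and> chain_bipartition E A B)"
proof
  assume "ESS E \<and> bipartite_graph V E"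
  then obtain A B where "ESS E" and AB: "A \<union> B = V" "A \<inter> B = {}" "\<forall>e\<in>E. \<exists>a\<in>A. \<exists>b\<in>B. e = {a, b}"
    unfolding bipartite_graph_def by blast
  have fin: "finite V" and card2: "\<And>e. e \<in> E \<Longrightarrow> card e = 2"
    using assms by (auto simp: finite_simple_graph_def)
  have "chain_bipartition E A B"
  proof
    show "finite A" "finite B" using AB fin by auto
    show "A \<inter> B = {}" by fact
    show "\<exists>a\<in>A. \<exists>b\<in>B. e = {a, b}" if "e \<in> E" for e using AB that by blast
    show "{a, b'} \<in> E \<or> {a', b} \<in> E"
      if h: "a \<in> A" "a' \<in> A" "b \<in> B" "b' \<in> B" "{a, b} \<in> E" "{a', b'} \<in> E" for a a' b b'
    proof (cases "a = a' \<or> b = b'")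
      case True
      then show ?thesis using h by auto
    next
      case False
      then have "{a, b} \<inter> {a', b'} = {}" using h AB by auto
      then obtain g where g: "g \<in> E" "g \<subseteq> {a, b} \<union> {a', b'}" "g \<noteq> {a, b}" "g \<noteq> {a', b'}"
        using ESS_joining_edge[OF \<open>ESS E\<close> card2 h(5,6)] by blast
      \<comment> \<open>A joining edge has one end on each side, which leaves four candidates, and
        two of them are the given edges.\<close>
      obtain p q where pq: "p \<in> A" "q \<in> B" "g = {p, q}" using AB(3) g(1) by blast
      then have "p \<in> {a, a'}" "q \<in> {b, b'}" using g(2) h AB(2) by auto
      then show ?thesis using g pq by auto
    qed
  qed
  then show "\<exists>A B. A \<union> B = V \<and> chain_bipartition E A B" using AB by blast
next
  assume "\<exists>A B. A \<union> B = V \<and> chain_bipartition E A B"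
  then obtain A B where AB: "A \<union> B = V" and "chain_bipartition E A B" by blast
  then interpret chain_bipartition E A B by simp
  have "bipartite_graph V E"
    unfolding bipartite_graph_def using AB disj edgeE by (intro exI[of _ A] exI[of _ B]) simp
  then show "ESS E \<and> bipartite_graph V E" using ESS_edges by simp
qed

section \<open>Constructed graphs are chain graphs\<close>

text \<open>All edges lie inside \<open>A \<union> B\<close>, where \<open>f\<close> is injective,
  so \<open>f\<close> reflects edges as well as preserving them, and \<open>cross\<close> can be
  pulled back.\<close>

lemma chain_bipartition_image:
  assumes "chain_bipartition E A B" and inj: "inj_on f (A \<union> B)"
  shows "chain_bipartition ((`) f ` E) (f ` A) (f ` B)"
proof -
  interpret chain_bipartition E A B by fact
  have edge: "{a, b} \<in> E" if ab: "a \<in> A" "b \<in> B" "{f a, f b} \<in> (`) f ` E" for a b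
  proof -
    obtain e where e: "e \<in> E" "{f a, f b} = f ` e" using ab by blast
    then have "e \<subseteq> A \<union> B" using edgeE by blast
    moreover have "f ` {a, b} = f ` e" using e by simp
    ultimately have "{a, b} = e" using inj ab by (subst (asm) inj_on_image_eq_iff) auto
    then show ?thesis using e by simp
  qed
  show ?thesis
  proof
    show "finite (f ` A)" "finite (f ` B)" using finA finB by auto
    show "f ` A \<inter> f ` B = {}" using inj disj by (auto simp: inj_on_def)
    show "\<exists>a\<in>f ` A. \<exists>b\<in>f ` B. e = {a, b}" if "e \<in> (`) f ` E" for e
      using that edgeE by fastforce
    show "{a, b'} \<in> (`) f ` E \<or> {a', b} \<in> (`) f ` E"
      if h: "a \<in> f ` A" "a' \<in> f ` A" "b \<in> f ` B" "b' \<in> f ` B" "{a, b} \<in> (`) f ` E" "{a', b'} \<in> (`) f ` E"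
      for a a' b b'
    proof -
      obtain p p' q q' where pq: "p \<in> A" "p' \<in> A" "q \<in> B" "q' \<in> B" "a = f p" "a' = f p'" "b = f q" "b' = f q'"
        using h by blast
      then have "{p, q'} \<in> E \<or> {p', q} \<in> E" using edge h cross by metis
      then have "f ` {p, q'} \<in> (`) f ` E \<or> f ` {p', q} \<in> (`) f ` E" by blast
      then show ?thesis by (simp add: pq)
    qed
  qed
qed

text \<open>Edges join consecutive layers only, so the layers alternate between the two sides.
  Within one pair of layers adjacency is a bound on an index, and two such bounds are always
  comparable.\<close>

lemma uds_chain_bipartition:
  assumes "upward_degree_sequences t d d'"
  shows "chain_bipartition (uds_edges t d d')
    (Xvert ` {1..t} \<union> Zvert ` {1..(if d 1 = 0 then 0 else d' 1)}) ({Wvert} \<union> Yvert ` {1..d 1})"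
proof -
  have t: "1 \<le> t" and d: "\<And>i j. 1 \<le> i \<Longrightarrow> i \<le> j \<Longrightarrow> j \<le> t \<Longrightarrow> d j \<le> d i"
    and d': "\<And>i j. 1 \<le> i \<Longrightarrow> i \<le> j \<Longrightarrow> j \<le> d t \<Longrightarrow> d' j \<le> d' i"
    using assms by (auto simp: upward_degree_sequences_def monotone_on_def)
  have d1: "d i \<le> d 1" if "1 \<le> i" "i \<le> t" for i using d that by auto
  have WX: "{Xvert i, Wvert} \<in> uds_edges t d d' \<longleftrightarrow> 1 \<le> i \<and> i \<le> t" for i
    by (auto simp: uds_edges_def doubleton_eq_iff)
  have XY: "{Xvert i, Yvert j} \<in> uds_edges t d d' \<longleftrightarrow> 1 \<le> i \<and> i \<le> t \<and> 1 \<le> j \<and> j \<le> d i" for i j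
    by (auto simp: uds_edges_def doubleton_eq_iff)
  have ZY: "{Zvert l, Yvert k} \<in> uds_edges t d d' \<longleftrightarrow> 1 \<le> k \<and> k \<le> d t \<and> 1 \<le> l \<and> l \<le> d' k" for k l
    by (auto simp: uds_edges_def doubleton_eq_iff)
  have ZW: "{Zvert l, Wvert} \<notin> uds_edges t d d'" for l
    by (auto simp: uds_edges_def doubleton_eq_iff)
  show ?thesis (is "chain_bipartition _ ?A ?B")
  proof
    show "finite ?A" "finite ?B" "?A \<inter> ?B = {}" by auto
    show "\<exists>a\<in>?A. \<exists>b\<in>?B. e = {a, b}" if "e \<in> uds_edges t d d'" for e
    proof -
      consider (WX) i where "e = {Xvert i, Wvert}" "1 \<le> i" "i \<le> t"
        | (XY) i j where "e = {Xvert i, Yvert j}" "1 \<le> i" "i \<le> t" "1 \<le> j" "j \<le> d i"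
        | (ZY) k l where "e = {Zvert l, Yvert k}" "1 \<le> k" "k \<le> d t" "1 \<le> l" "l \<le> d' k"
        using \<open>e \<in> uds_edges t d d'\<close> unfolding uds_edges_def
        by (auto simp: insert_commute)
      then show ?thesis
      proof cases
        case WX
        then show ?thesis by auto
      next
        case XY
        then have "Xvert i \<in> ?A" "Yvert j \<in> ?B" using d1[of i] by auto
        then show ?thesis using XY(1) by blast
      next
        case ZY
        \<comment> \<open>The chain \<open>1 \<le> k \<le> d t \<le> d 1\<close> rules out the
          default value 0, and \<open>l \<le> d' k \<le> d' 1\<close> bounds the index.\<close>
        then have "Zvert l \<in> ?A" "Yvert k \<in> ?B" using d1[of t] t d'[of 1 k] by auto
        then show ?thesis using ZY(1) by blast
      qed
    qed
    show "{a, b'} \<in> uds_edges t d d' \<or> {a', b} \<in> uds_edges t d d'"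
      if "a \<in> ?A" "a' \<in> ?A" "b \<in> ?B" "b' \<in> ?B" "{a, b} \<in> uds_edges t d d'" "{a', b'} \<in> uds_edges t d d'"
      for a a' b b'
    proof -
      \<comment> \<open>This settles the mixed case: a \<open>Yvert\<close> with a neighbour among
        the \<open>Zvert\<close> is adjacent to every \<open>Xvert\<close>.\<close>
      have XZ: "k \<le> d i" if "1 \<le> i" "i \<le> t" "k \<le> d t" for i k
        using d[of i t] that by linarith
      show ?thesis
        using that by (elim UnE imageE insertE emptyE) (auto simp: WX XY ZY ZW intro: XZ)
    qed
  qed
qed

lemma constructible_from_chain:
  assumes "constructible_from V E v"
  shows "\<exists>A B. A \<union> B = V \<and> chain_bipartition E A B"
proof -
  obtain t d d' f where u: "upward_degree_sequences t d d'" and bij: "bij_betw f (uds_vertices t d d') V"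
    and E: "(`) f ` uds_edges t d d' = E"
    using assms unfolding constructible_from_def by blast
  let ?A = "Xvert ` {1..t} \<union> Zvert ` {1..(if d 1 = 0 then 0 else d' 1)}"
  let ?B = "{Wvert} \<union> Yvert ` {1..d 1}"
  have "uds_vertices t d d' = ?A \<union> ?B" by (auto simp: uds_vertices_def)
  then have "inj_on f (?A \<union> ?B)" "f ` ?A \<union> f ` ?B = V"
    using bij unfolding bij_betw_def by (simp_all only: image_Un)
  then show ?thesis
    using chain_bipartition_image[OF uds_chain_bipartition[OF u]] E by blast
qed

section \<open>Sorted enumerations and initial segments\<close>

lemma enumerate_antimono:
  fixes f :: "'a \<Rightarrow> nat"
  assumes "finite S"
  shows "\<exists>x. bij_betw x {1..card S} S \<and> antimono_on {1..card S} (f \<circ> x)"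
  using assms
proof (induction S rule: finite_ranking_induct[where f = "\<lambda>a. - int (f a)"])
  case empty
  show ?case by (auto simp: bij_betw_def)
next
  case (insert a S)
  show ?case
  proof (cases "a \<in> S")
    case True
    then show ?thesis using insert.IH by (simp add: insert_absorb)
  next
    case False
    obtain x where x: "bij_betw x {1..card S} S" "antimono_on {1..card S} (f \<circ> x)"
      using insert.IH by blast
    have card: "card (insert a S) = Suc (card S)" using False insert.hyps by simp
    have upd: "(x(Suc (card S) := a)) i = x i" if "i \<in> {1..card S}" for i using that by auto
    have "bij_betw (x(Suc (card S) := a)) {1..card S} S"
      using x(1) upd by (subst bij_betw_cong[of _ _ x]) auto
    \<comment> \<open>The new element \<open>a\<close> of the range is first rewritten as the value
      at the new index, the form in which a bijection can be extended by one point.\<close>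
    then have "bij_betw (x(Suc (card S) := a)) (insert (Suc (card S)) {1..card S}) (insert a S)"
      using False by (subst (2) fun_upd_same[of x "Suc (card S)" a, symmetric], subst notIn_Un_bij_betw3[symmetric, simplified]) auto
    moreover have "insert (Suc (card S)) {1..card S} = {1..card (insert a S)}" unfolding card by auto
    moreover have "antimono_on {1..card (insert a S)} (f \<circ> (x(Suc (card S) := a)))"
    proof (rule monotone_onI)
      fix i j assume ij: "i \<in> {1..card (insert a S)}" "j \<in> {1..card (insert a S)}" "i \<le> j"
      have "x i \<in> S" if "i \<in> {1..card S}" for i using x(1) that by (auto simp: bij_betw_def)
      then have "f a \<le> f (x i)" if "i \<in> {1..card S}" for i using insert.hyps that by force
      then show "(f \<circ> (x(Suc (card S) := a))) j \<le> (f \<circ> (x(Suc (card S) := a))) i"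
        using ij x(2) unfolding card by (auto simp: monotone_on_def)
    qed
    ultimately show ?thesis by metis
  qed
qed

text \<open>The indices that \<open>y\<close> sends into \<open>S\<close> form a downward closed
  subset of \<open>{1..n}\<close>, and such a set is determined by its size. This turns
  neighbourhoods into the initial segments of the construction.\<close>

lemma initial_segment_iff:
  assumes bij: "bij_betw y {1..n} Y" and "S \<subseteq> Y"
    and down: "\<And>i j. 1 \<le> i \<Longrightarrow> i \<le> j \<Longrightarrow> j \<le> n \<Longrightarrow> y j \<in> S \<Longrightarrow> y i \<in> S"
    and i: "1 \<le> i" "i \<le> n"
  shows "y i \<in> S \<longleftrightarrow> i \<le> card S"
proof -
  define I where "I = {i \<in> {1..n}. y i \<in> S}"
  have "y ` I = S" using bij \<open>S \<subseteq> Y\<close> by (auto simp: I_def bij_betw_def)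
  moreover have "inj_on y I" using bij by (rule inj_on_subset[OF bij_betw_imp_inj_on]) (auto simp: I_def)
  ultimately have card: "card S = card I" by (metis card_image)
  have fin: "finite I" by (simp add: I_def)
  show ?thesis
  proof
    assume "y i \<in> S"
    then have "{1..i} \<subseteq> I" using down[of _ i] i by (auto simp: I_def)
    then show "i \<le> card S" using card card_mono[OF fin, of "{1..i}"] by simp
  next
    assume le: "i \<le> card S"
    show "y i \<in> S"
    proof (rule ccontr)
      assume "y i \<notin> S"
      \<comment> \<open>Otherwise every index of \<open>S\<close> would lie below \<open>i\<close>,
        leaving at most \<open>i - 1\<close> of them.\<close>
      then have "\<not> i \<le> j" if "j \<in> I" for j using that down[of i j] i(1) by (auto simp: I_def)
      then have "I \<subseteq> {1..<i}" by (auto simp: I_def not_le)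
      then have "card I \<le> i - 1" using card_mono[of "{1..<i}" I] by simp
      then show False using le card i by simp
    qed
  qed
qed

section \<open>Constructing a chain graph from a given vertex\<close>

text \<open>The layers are the neighbours \<open>X\<close> of \<open>v\<close>, the rest
  \<open>Y\<close> of its side, and the rest \<open>Z\<close> of the other side. Absence of isolated
  vertices makes \<open>X\<close> nonempty, lets \<open>x 1\<close> reach all of \<open>Y\<close>,
  and lets \<open>y 1\<close> reach all of \<open>Z\<close> if \<open>Y\<close> is nonempty.\<close>

lemma (in chain_bipartition) constructible_from_right:
  assumes iso: "no_isolated_vertex (A \<union> B) E" and "v \<in> B"
  shows "constructible_from (A \<union> B) E v"
proof -
  interpret sw: chain_bipartition E B A by (rule swap)
  define X Y Z where "X = nbhd E v" and "Y = B - {v}" and "Z = A - X"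
  have fin: "finite X" "finite Y" "finite Z" and XA: "X \<subseteq> A"
    using sw.finite_nbhd[OF \<open>v \<in> B\<close>] sw.nbhd_subset[OF \<open>v \<in> B\<close>] finA finB
    by (auto simp: X_def Y_def Z_def)
  have edge_at: "nbhd E u \<noteq> {}" if u: "u \<in> A \<union> B" for u
  proof -
    obtain e where "e \<in> E" "u \<in> e" using iso u unfolding no_isolated_vertex_def by blast
    moreover then obtain a b where "e = {a, b}" using edgeE by blast
    ultimately show ?thesis by (auto simp: nbhd_def insert_commute)
  qed
  define t n m where "t = card X" and "n = card Y" and "m = card Z"
  have "X \<noteq> {}" using edge_at \<open>v \<in> B\<close> by (simp add: X_def)
  then have t: "1 \<le> t" using fin by (simp add: t_def Suc_le_eq card_gt_0_iff)
  obtain x where x: "bij_betw x {1..t} X" "antimono_on {1..t} ((\<lambda>u. card (nbhd E u)) \<circ> x)"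
    unfolding t_def using enumerate_antimono[OF fin(1)] by blast
  obtain y where y: "bij_betw y {1..n} Y" "antimono_on {1..n} ((\<lambda>u. card (nbhd E u)) \<circ> y)"
    unfolding n_def using enumerate_antimono[OF fin(2)] by blast
  obtain z where z: "bij_betw z {1..m} Z" "antimono_on {1..m} ((\<lambda>u. card (nbhd E u)) \<circ> z)"
    unfolding m_def using enumerate_antimono[OF fin(3)] by blast
  have x_img: "x ` {1..t} = X" and y_img: "y ` {1..n} = Y" and z_img: "z ` {1..m} = Z"
    using x(1) y(1) z(1) by (auto simp: bij_betw_def)
  have xX: "x i \<in> X" if "1 \<le> i" "i \<le> t" for i using x_img that by force
  have yY: "y i \<in> Y" if "1 \<le> i" "i \<le> n" for i using y_img that by force
  have zZ: "z i \<in> Z" if "1 \<le> i" "i \<le> m" for i using z_img that by force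
  have x_mono: "nbhd E (x j) \<subseteq> nbhd E (x i)" if "1 \<le> i" "i \<le> j" "j \<le> t" for i j
    using that xX[of i] xX[of j] XA monotone_onD[OF x(2), of i j] by (intro nbhd_mono) auto
  have y_mono: "nbhd E (y j) \<subseteq> nbhd E (y i)" if "1 \<le> i" "i \<le> j" "j \<le> n" for i j
    using that yY[of i] yY[of j] monotone_onD[OF y(2), of i j] by (intro sw.nbhd_mono) (auto simp: Y_def)
  have z_mono: "nbhd E (z j) \<subseteq> nbhd E (z i)" if "1 \<le> i" "i \<le> j" "j \<le> m" for i j
    using that zZ[of i] zZ[of j] monotone_onD[OF z(2), of i j] by (intro nbhd_mono) (auto simp: Z_def)

  \<comment> \<open>Only neighbours in the next layer count: \<open>v\<close> is removed for
    \<open>x i\<close>, and the neighbours in \<open>X\<close> are ignored for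
    \<open>y k\<close>.\<close>
  define d where "d i = card (nbhd E (x i) - {v})" for i
  define d' where "d' k = card (nbhd E (y k) \<inter> Z)" for k
  have xv: "{x i, v} \<in> E" if "1 \<le> i" "i \<le> t" for i
    using xX[OF that] by (simp add: X_def nbhd_def insert_commute)
  have xy: "{x i, y j} \<in> E \<longleftrightarrow> j \<le> d i" if i: "1 \<le> i" "i \<le> t" and j: "1 \<le> j" "j \<le> n" for i j
  proof -
    have "y j \<in> nbhd E (x i) - {v} \<longleftrightarrow> j \<le> d i"
      unfolding d_def
    proof (rule initial_segment_iff[OF y(1) _ _ j])
      show "nbhd E (x i) - {v} \<subseteq> Y"
        using nbhd_subset[of "x i"] xX[OF i] XA by (auto simp: Y_def)
      \<comment> \<open>Downward closure is read from the other end: \<open>x i\<close> lies in the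
        neighbourhood of \<open>y l\<close>, which is contained in that of
        \<open>y k\<close>.\<close>
      show "y k \<in> nbhd E (x i) - {v}"
        if "1 \<le> k" "k \<le> l" "l \<le> n" "y l \<in> nbhd E (x i) - {v}" for k l
        using that y_mono[of k l] yY[of k] nbhd_sym[of _ E "x i"] by (auto simp: Y_def)
    qed
    then show ?thesis using yY[OF j] by (auto simp: Y_def nbhd_def)
  qed
  have yz: "{y k, z l} \<in> E \<longleftrightarrow> l \<le> d' k" if k: "1 \<le> k" "k \<le> n" and l: "1 \<le> l" "l \<le> m" for k l
  proof -
    have "z l \<in> nbhd E (y k) \<inter> Z \<longleftrightarrow> l \<le> d' k"
      unfolding d'_def
    proof (rule initial_segment_iff[OF z(1) _ _ l])
      show "nbhd E (y k) \<inter> Z \<subseteq> Z" by simp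
      show "z i \<in> nbhd E (y k) \<inter> Z"
        if "1 \<le> i" "i \<le> j" "j \<le> m" "z j \<in> nbhd E (y k) \<inter> Z" for i j
        using that z_mono[of i j] zZ[of i] nbhd_sym[of _ E "y k"] by auto
    qed
    then show ?thesis using zZ[OF l] by (auto simp: nbhd_def)
  qed
  have d_le: "d i \<le> n" if "1 \<le> i" "i \<le> t" for i
    unfolding d_def n_def using nbhd_subset[of "x i"] xX[OF that] XA
    by (intro card_mono fin) (auto simp: Y_def)
  have d'_le: "d' k \<le> m" for k
    unfolding d'_def m_def by (intro card_mono) (auto simp: fin)
  \<comment> \<open>The edges from \<open>x t\<close> to \<open>v\<close> and from \<open>c\<close>
    to \<open>y k\<close> must be joined. As \<open>c\<close> is not adjacent to \<open>v\<close>,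
    the joining edge is \<open>{x t, y k}\<close>.\<close>
  have yz_small: "k \<le> d t" if k: "1 \<le> k" "k \<le> n" and c: "c \<in> nbhd E (y k) \<inter> Z" for k c
  proof -
    have "{c, v} \<notin> E" using c by (auto simp: Z_def X_def nbhd_def insert_commute)
    moreover have "{c, y k} \<in> E" using c by (auto simp: nbhd_def insert_commute)
    ultimately have "{x t, y k} \<in> E"
      using cross[of "x t" c v "y k"] xv[of t] xX[of t] XA yY[OF k] c \<open>v \<in> B\<close> t
      unfolding Y_def Z_def by blast
    then show ?thesis using xy[of t k] k t by simp
  qed
  have "B \<subseteq> nbhd E (x 1)"
  proof
    fix b assume b: "b \<in> B"
    then obtain a where a: "a \<in> A" "{a, b} \<in> E"
      using edge_at[of b] sw.nbhd_subset[of b] by (auto simp: nbhd_def insert_commute)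
    \<comment> \<open>Either the joining edge is the desired one, or \<open>a\<close> is some
      \<open>x i\<close>, whose neighbourhood is contained in that of \<open>x 1\<close>.\<close>
    have "{x 1, b} \<in> E \<or> {a, v} \<in> E"
      using cross[of "x 1" a v b] xv[of 1] xX[of 1] XA a b \<open>v \<in> B\<close> t by auto
    then show "b \<in> nbhd E (x 1)"
    proof
      assume "{a, v} \<in> E"
      then have "a \<in> X" by (simp add: X_def nbhd_def insert_commute)
      then obtain i where "i \<in> {1..t}" "a = x i" using x_img by blast
      then show ?thesis using x_mono[of 1 i] a by (auto simp: nbhd_def)
    qed (simp add: nbhd_def)
  qed
  then have "nbhd E (x 1) = B" using nbhd_subset[of "x 1"] xX[of 1] XA t by auto
  then have d_1: "d 1 = n" by (simp add: d_def n_def Y_def)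
  have Z_nbhd: "\<exists>k\<in>{1..n}. c \<in> nbhd E (y k)" if c: "c \<in> Z" for c
  proof -
    obtain b where b: "b \<in> B" "{c, b} \<in> E"
      using edge_at[of c] nbhd_subset[of c] c by (auto simp: Z_def nbhd_def)
    then have "b \<in> Y" using c by (auto simp: X_def Y_def Z_def nbhd_def insert_commute)
    then show ?thesis using y_img b by (fastforce simp: nbhd_def insert_commute)
  qed
  \<comment> \<open>If \<open>Y\<close> is empty then so is \<open>Z\<close>, in agreement with the
    default 0; otherwise \<open>y 1\<close> has the largest neighbourhood, hence is adjacent to all
    of \<open>Z\<close>.\<close>
  have d'_1: "(if d 1 = 0 then 0 else d' 1) = m"
  proof (cases "n = 0")
    case True
    then have "Z = {}" using Z_nbhd by fastforce
    then show ?thesis unfolding d_1 using True by (simp add: m_def)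
  next
    case False
    have "nbhd E (y k) \<subseteq> nbhd E (y 1)" if "k \<in> {1..n}" for k using y_mono[of 1 k] that by simp
    then have "Z \<subseteq> nbhd E (y 1)" using Z_nbhd by blast
    then show ?thesis unfolding d_1 using False by (simp add: m_def d'_def Int_absorb1)
  qed

  have seqs: "upward_degree_sequences t d d'"
    unfolding upward_degree_sequences_def
  proof (intro conjI allI impI)
    show "1 \<le> t" by (rule t)
    show "antimono_on {1..t} d"
    proof (rule monotone_onI)
      fix i j assume "i \<in> {1..t}" "j \<in> {1..t}" "i \<le> j"
      then show "d j \<le> d i"
        unfolding d_def using x_mono[of i j] finite_nbhd[of "x i"] xX[of i] XA by (intro card_mono) auto
    qed
    show "antimono_on {1..d t} d'"
    proof (rule monotone_onI)
      fix i j assume "i \<in> {1..d t}" "j \<in> {1..d t}" "i \<le> j"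
      then show "d' j \<le> d' i"
        unfolding d'_def using y_mono[of i j] fin d_le[of t] t by (intro card_mono) auto
    qed
    show "d' k = 0" if "d t < k \<and> k \<le> d 1" for k
    proof -
      have "1 \<le> k" "k \<le> n" "\<not> k \<le> d t" using that unfolding d_1 by simp_all
      then have "nbhd E (y k) \<inter> Z = {}" using yz_small[of k] by blast
      then show ?thesis by (simp add: d'_def)
    qed
  qed

  define f where "f = case_uds_vertex v x y z"
  have f [simp]: "f Wvert = v" "f (Xvert i) = x i" "f (Yvert i) = y i" "f (Zvert i) = z i" for i
    by (simp_all add: f_def)
  have verts: "uds_vertices t d d' = {Wvert} \<union> Xvert ` {1..t} \<union> Yvert ` {1..n} \<union> Zvert ` {1..m}"
    unfolding uds_vertices_def d'_1 unfolding d_1 ..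
  have "bij_betw f (Xvert ` {1..t}) X" "bij_betw f (Yvert ` {1..n}) Y" "bij_betw f (Zvert ` {1..m}) Z"
    using x(1) y(1) z(1) unfolding bij_betw_def
    by (auto intro!: inj_on_imageI simp: comp_def image_image)
  moreover have "bij_betw f {Wvert} {v}" by (simp add: bij_betw_def)
  moreover have "{v} \<inter> X = {}" "({v} \<union> X) \<inter> Y = {}" "({v} \<union> X \<union> Y) \<inter> Z = {}"
    using XA disj \<open>v \<in> B\<close> by (auto simp: Y_def Z_def)
  ultimately have "bij_betw f (uds_vertices t d d') ({v} \<union> X \<union> Y \<union> Z)"
    unfolding verts by (intro bij_betw_combine)
  moreover have "{v} \<union> X \<union> Y \<union> Z = A \<union> B" using XA \<open>v \<in> B\<close> by (auto simp: Y_def Z_def)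
  ultimately have bij: "bij_betw f (uds_vertices t d d') (A \<union> B)" by simp

  have "(`) f ` uds_edges t d d' = E"
  proof (intro equalityI subsetI)
    fix e assume "e \<in> (`) f ` uds_edges t d d'"
    then obtain e' where e': "e' \<in> uds_edges t d d'" "e = f ` e'" by blast
    consider (WX) i where "e' = {Wvert, Xvert i}" "1 \<le> i" "i \<le> t"
      | (XY) i j where "e' = {Xvert i, Yvert j}" "1 \<le> i" "i \<le> t" "1 \<le> j" "j \<le> d i"
      | (YZ) k l where "e' = {Yvert k, Zvert l}" "1 \<le> k" "k \<le> d t" "1 \<le> l" "l \<le> d' k"
      using e'(1) unfolding uds_edges_def by auto
    then show "e \<in> E"
    proof cases
      case WX
      then show ?thesis using e'(2) xv[of i] by (simp add: insert_commute)
    next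
      case XY
      then show ?thesis using e'(2) xy[of i j] d_le[of i] by simp
    next
      case YZ
      then show ?thesis using e'(2) yz[of k l] d_le[of t] d'_le[of k] t by simp
    qed
  next
    fix e assume e: "e \<in> E"
    then obtain a b where ab: "a \<in> A" "b \<in> B" "e = {a, b}" using edgeE by blast
    have "\<exists>e'\<in>uds_edges t d d'. e = f ` e'"
    proof (cases "a \<in> X")
      case True
      then obtain i where i: "1 \<le> i" "i \<le> t" "a = x i" using x_img by force
      show ?thesis
      proof (cases "b = v")
        case True
        have "{Wvert, Xvert i} \<in> uds_edges t d d'" using i by (auto simp: uds_edges_def)
        moreover have "e = f ` {Wvert, Xvert i}" using True i ab by auto
        ultimately show ?thesis by blast
      next
        case False
        then have "b \<in> Y" using ab by (simp add: Y_def)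
        then obtain j where j: "1 \<le> j" "j \<le> n" "b = y j" using y_img by force
        then have "j \<le> d i" using xy[of i j] i e ab by simp
        then have "{Xvert i, Yvert j} \<in> uds_edges t d d'" using i j by (auto simp: uds_edges_def)
        moreover have "e = f ` {Xvert i, Yvert j}" using i j ab by auto
        ultimately show ?thesis by blast
      qed
    next
      case False
      then have "a \<in> Z" using ab by (simp add: Z_def)
      then obtain l where l: "1 \<le> l" "l \<le> m" "a = z l" using z_img by force
      have "b \<noteq> v" using False e ab by (auto simp: X_def nbhd_def insert_commute)
      then have "b \<in> Y" using ab by (simp add: Y_def)
      then obtain k where k: "1 \<le> k" "k \<le> n" "b = y k" using y_img by force
      have yz_E: "{y k, z l} \<in> E" using e ab k l by (simp add: insert_commute)
      then have "l \<le> d' k" using yz[of k l] k l by simp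
      \<comment> \<open>The construction draws edges into the last layer only from the first
        \<open>d t\<close> vertices of \<open>Y\<close>; the neighbour \<open>z l\<close> places
        \<open>y k\<close> among them.\<close>
      moreover have "k \<le> d t" using yz_small[of k "z l"] yz_E k l zZ[of l] by (simp add: nbhd_def)
      ultimately have "{Yvert k, Zvert l} \<in> uds_edges t d d'" using k l by (auto simp: uds_edges_def)
      moreover have "e = f ` {Yvert k, Zvert l}" using k l ab by auto
      ultimately show ?thesis by blast
    qed
    then show "e \<in> (`) f ` uds_edges t d d'" by blast
  qed
  then show ?thesis unfolding constructible_from_def using seqs bij f(1) by blast
qed

theorem theorem5p9:
  fixes V :: "'a set" and E :: "'a set set"
  assumes "finite_simple_graph V E"
    and "connected_graph V E"
    and "no_isolated_vertex V E"
  shows "(ESS E \<and> bipartite_graph V E \<longleftrightarrow> (\<forall>v\<in>V. constructible_from V E v)) \<and>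
    ((\<forall>v\<in>V. constructible_from V E v) \<longleftrightarrow> (\<exists>v\<in>V. constructible_from V E v))"
proof -
  \<comment> \<open>The vertex \<open>v\<close> may lie on either side; exchanging the sides reduces
    both cases to the previous lemma.\<close>
  have "constructible_from V E v" if "A \<union> B = V" "chain_bipartition E A B" "v \<in> V" for A B v
    using chain_bipartition.constructible_from_right[OF that(2), of v]
      chain_bipartition.constructible_from_right[OF chain_bipartition.swap[OF that(2)], of v]
      that assms(3) by (auto simp: Un_commute)
  \<comment> \<open>A vertex must exist for the universal statement to yield the existential
    one.\<close>
  moreover have "V \<noteq> {}" using assms(2) by (simp add: connected_graph_def)
  ultimately show ?thesis
    using ESS_bipartite_iff_chain[OF assms(1)] constructible_from_chain[of V E] by (metis ex_in_conv)
qed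

end
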